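(* Let $a,b,c,\alpha,\beta,\gamma$ be integers with $0\le\alpha<a$, $0\le\beta<b$, $0\le\gamma<c$ and at most one of $\alpha,\beta,\gamma$ zero. Suppose $a+b+c+\alpha+\beta+\gamma\equiv 0\pmod 3$, put $s=\frac13(a+b+c+\alpha+\beta+\gamma)-2$, $A=s+2-a$, $B=s+2-b$, $C=s+2-c$, $M=s+2-(\alpha+\beta+\gamma)$, and assume $0\le M$, $0\le A\le\beta+\gamma$, $0\le B\le\alpha+\gamma$, $0\le C\le\alpha+\beta$. If $c$ and $\gamma$ are odd, $a=b$, and $\alpha=\beta$, then the punctured hexagon $H_{a,a,c,\alpha,\alpha,\gamma}$ is symmetric with an odd puncture (i.e. $M$ is odd), and $$\det N_{a,a,c,\alpha,\alpha,\gamma}=0.$$ Thus, for every infinite field $K$ (regardless of characteristic), the quotient of $K[x,y,z]$ by $I_{a,a,c,\alpha,\alpha,\gamma}=(x^a,y^a,z^c,x^\alpha y^\alpha z^\gamma)$ does not have the weak Lefschetz property.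
   Context: $N_{a,b,c,\alpha,\beta,\gamma}$ is the $(C+M)\times(C+M)$ integer matrix with $(i,j)$ entry $\binom{c}{A+j-i}$ if $1\le i\le C$ and $\binom{\gamma}{A+C-\beta+j-i}$ if $C+1\le i\le C+M$, where $\binom nk=0$ if $k<0$ or $k>n$ (determinant of the empty matrix is $1$). $H_{a,b,c,\alpha,\beta,\gamma}$ is the region in the equilateral triangle $\{(u,v,w): u,v,w\ge0,\ u+v+w=s+2\}$ consisting of the points with $u\le a$, $v\le b$, $w\le c$, with the triangular puncture $\{u\ge\alpha,\ v\ge\beta,\ w\ge\gamma\}$ of side-length $M$ removed. "Symmetric" means invariant under the reflection $(u,v,w)\mapsto(v,u,w)$. An artinian standard graded $K$-algebra $Q$ has the weak Lefschetz property if there is a linear form $\ell\in[Q]_1$ such that for all integers $d$ the map $\times\ell:[Q]_d\to[Q]_{d+1}$ is injective or surjective. *)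

theory Defs
  imports
    Complex_Main
    "HOL-Number_Theory.Cong"
    "HOL-Library.Poly_Mapping"
    "HOL-Algebra.QuotRing"
    "HOL-Algebra.Algebraic_Closure_Type"
    "Jordan_Normal_Form.Determinant"
begin

definition s_param :: "int \<Rightarrow> int \<Rightarrow> int \<Rightarrow> int \<Rightarrow> int \<Rightarrow> int \<Rightarrow> int" where
  "s_param a b c \<alpha> \<beta> \<gamma> = (a + b + c + \<alpha> + \<beta> + \<gamma>) div 3 - 2"

text \<open>The binomial coefficient at integer arguments, zero unless \<open>0 \<le> k \<le> n\<close>.
  (This is not \<open>gchoose\<close>, which is nonzero at negative upper arguments.)\<close>

definition int_binomial :: "int \<Rightarrow> int \<Rightarrow> int" where
  "int_binomial n k = (if k < 0 \<or> k > n then 0 else int (nat n choose nat k))"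

text \<open>Matrices of type \<open>int mat\<close> are indexed from 0, whereas the formula for the entries is stated
  for indices starting at 1; hence the shift \<open>i = int i' + 1\<close>, \<open>j = int j' + 1\<close>.\<close>

definition N_matrix :: "int \<Rightarrow> int \<Rightarrow> int \<Rightarrow> int \<Rightarrow> int \<Rightarrow> int \<Rightarrow> int mat" where
  "N_matrix a b c \<alpha> \<beta> \<gamma> =
    (let s = s_param a b c \<alpha> \<beta> \<gamma>;
         A = s + 2 - a;
         C = s + 2 - c;
         M = s + 2 - (\<alpha> + \<beta> + \<gamma>)
     in mat (nat (C + M)) (nat (C + M))
          (\<lambda>(i', j').
            let i = int i' + 1; j = int j' + 1
            in if i \<le> C then int_binomial c (A + j - i)
               else int_binomial \<gamma> (A + C - \<beta> + j - i)))"

definition puncture ::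
  "int \<Rightarrow> int \<Rightarrow> int \<Rightarrow> int \<Rightarrow> int \<Rightarrow> int \<Rightarrow> (real \<times> real \<times> real) set" where
  "puncture a b c \<alpha> \<beta> \<gamma> =
    {(u, v, w). u + v + w = of_int (s_param a b c \<alpha> \<beta> \<gamma> + 2)
       \<and> u \<ge> of_int \<alpha> \<and> v \<ge> of_int \<beta> \<and> w \<ge> of_int \<gamma>}"

definition punctured_hexagon ::
  "int \<Rightarrow> int \<Rightarrow> int \<Rightarrow> int \<Rightarrow> int \<Rightarrow> int \<Rightarrow> (real \<times> real \<times> real) set" where
  "punctured_hexagon a b c \<alpha> \<beta> \<gamma> =
    {(u, v, w). u \<ge> 0 \<and> v \<ge> 0 \<and> w \<ge> 0 \<and> u + v + w = of_int (s_param a b c \<alpha> \<beta> \<gamma> + 2)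
       \<and> u \<le> of_int a \<and> v \<le> of_int b \<and> w \<le> of_int c}
    - puncture a b c \<alpha> \<beta> \<gamma>"

definition symmetric_region :: "(real \<times> real \<times> real) set \<Rightarrow> bool" where
  "symmetric_region S \<longleftrightarrow> (\<lambda>(u, v, w). (v, u, w)) ` S = S"

datatype var3 = VX | VY | VZ

text \<open>Polynomials in three variables over \<open>'k\<close>, as finitely supported functions from exponent
  vectors \<open>var3 \<Rightarrow>\<^sub>0 nat\<close> to \<open>'k\<close>, with the convolution product of \<open>Poly_Mapping\<close>.\<close>

type_synonym 'k poly3 = "(var3 \<Rightarrow>\<^sub>0 nat) \<Rightarrow>\<^sub>0 'k"

definition Var :: "var3 \<Rightarrow> 'k::field poly3" where
  "Var v = Poly_Mapping.single (Poly_Mapping.single v 1) 1"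

abbreviation poly3_ring :: "'k::field poly3 ring" where
  "poly3_ring \<equiv> ring_of_type_algebra"

definition exp_degree :: "(var3 \<Rightarrow>\<^sub>0 nat) \<Rightarrow> nat" where
  "exp_degree m = Poly_Mapping.lookup m VX + Poly_Mapping.lookup m VY + Poly_Mapping.lookup m VZ"

text \<open>Homogeneous polynomials of degree \<open>d\<close>, including 0; for \<open>d < 0\<close> only 0 remains.\<close>

definition forms :: "int \<Rightarrow> 'k::field poly3 set" where
  "forms d = {p. \<forall>m \<in> Poly_Mapping.keys p. int (exp_degree m) = d}"

definition ideal_I :: "int \<Rightarrow> int \<Rightarrow> int \<Rightarrow> int \<Rightarrow> int \<Rightarrow> int \<Rightarrow> 'k::field poly3 set" where
  "ideal_I a b c \<alpha> \<beta> \<gamma> =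
    Idl\<^bsub>poly3_ring\<^esub> {Var VX ^ nat a, Var VY ^ nat b, Var VZ ^ nat c,
      Var VX ^ nat \<alpha> * Var VY ^ nat \<beta> * Var VZ ^ nat \<gamma>}"

text \<open>The degree \<open>d\<close> component of the quotient by a homogeneous ideal: the classes of forms of
  degree \<open>d\<close>.\<close>

definition quot_component :: "'k::field poly3 set \<Rightarrow> int \<Rightarrow> 'k poly3 set set" where
  "quot_component I d = (\<lambda>p. I +>\<^bsub>poly3_ring\<^esub> p) ` forms d"

text \<open>Intended for an artinian standard graded algebra \<open>Q\<close> with components \<open>G d\<close>, \<open>d \<in> \<int>\<close>.\<close>

definition weak_Lefschetz :: "('q, 'm) ring_scheme \<Rightarrow> (int \<Rightarrow> 'q set) \<Rightarrow> bool" where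
  "weak_Lefschetz Q G \<longleftrightarrow>
    (\<exists>l \<in> G 1. \<forall>d. inj_on (\<lambda>q. l \<otimes>\<^bsub>Q\<^esub> q) (G d) \<or> (\<lambda>q. l \<otimes>\<^bsub>Q\<^esub> q) ` G d = G (d + 1))"

end

theory Submission
  imports Defs
begin

text \<open>
  With \<open>a = b\<close> and \<open>\<alpha> = \<beta>\<close>, oddness of \<open>c\<close> and \<open>\<gamma>\<close> makes \<open>3 (s + 2) = 2 a + c + 2 \<alpha> + \<gamma>\<close> even, so \<open>s\<close> is
  even and both \<open>C\<close> and \<open>M\<close> are odd. The vanishing of \<open>det N\<close> and the failure of the weak
  Lefschetz property then come from one observation about integer matrices. If a square matrix is
  unchanged by an involution of its rows together with an involution of its columns, then its
  determinant equals itself times the product of the two signs. An involution of \<open>n\<close> points with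
  \<open>f\<close> fixed points has sign \<open>(-1) ^ ((n - f) div 2)\<close>, so as soon as the two numbers of fixed points
  differ by 2 the signs are opposite and the determinant is 0 (\<open>det_zero_of_involutions\<close>).

  For the matrix \<open>N\<close>, reverse the order of the columns and, separately, the order of the first \<open>C\<close>
  and of the last \<open>M\<close> rows; the symmetry of the binomial coefficients makes this a symmetry of \<open>N\<close>.
  As \<open>C\<close> and \<open>M\<close> are both odd, two rows and no column are fixed.

  For the weak Lefschetz property, let \<open>Z\<close> be the matrix of multiplication by \<open>x + y + z\<close> from
  degree \<open>s\<close> to degree \<open>s + 1\<close> in the bases of monomials outside the ideal. Exchanging \<open>x\<close> and \<open>y\<close>
  is a symmetry of \<open>Z\<close>. Multiplication by \<open>z\<close> matches the monomials of the two degrees, up to \<open>C + M\<close>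
  exceptional monomials on either side; among the exceptional monomials exactly two of degree
  \<open>s\<close>, and none of degree \<open>s + 1\<close>, are symmetric in \<open>x\<close> and \<open>y\<close>. Hence \<open>Z\<close> is square and, again,
  \<open>det Z = 0\<close>. Since this holds over the integers it holds over every field.

  For an arbitrary linear form \<open>p x + q y + r z\<close>, each nonzero term in the Leibniz expansion of the
  determinant of its multiplication matrix pairs every monomial of degree \<open>s\<close> with a multiple of
  degree \<open>s + 1\<close>, so the product of all quotients is the same monomial for every term. Thus the determinant is \<open>p ^ i * q ^ j * r ^ k * det Z\<close> with fixed exponents
  (\<open>linear_weight_prod\<close>), and the multiplication map between two spaces of the same dimension is
  singular, neither injective nor surjective.
\<close>

section \<open>Matrices invariant under a pair of involutions\<close>

lemma involution_permutes:
  assumes "\<And>x. x \<in> S \<Longrightarrow> p x \<in> S \<and> p (p x) = x" and "\<And>x. x \<notin> S \<Longrightarrow> p x = x"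
  shows "p permutes S"
  unfolding permutes_def using assms by metis

text \<open>Multiplying an involution by one of its own transpositions leaves an involution that moves two
  points less.\<close>
lemma sign_involution:
  fixes p :: "'a \<Rightarrow> 'a"
  assumes "finite S" "p permutes S" "\<And>x. p (p x) = x"
  shows "\<exists>k. card {x. p x \<noteq> x} = 2 * k \<and> sign p = (-1) ^ k"
  using assms(2,3)
proof (induction "card {x. p x \<noteq> x}" arbitrary: p rule: less_induct)
  case less
  let ?D = "{x. p x \<noteq> x}"
  have "?D \<subseteq> S" using less.prems(1) by (auto simp: permutes_def)
  then have fin: "finite ?D" using assms(1) finite_subset by blast
  show ?case
  proof (cases "?D = {}")
    case True
    then have "p = id" by auto
    then show ?thesis by (intro exI[of _ 0]) simp
  next
    case False
    then obtain a where a: "p a \<noteq> a" by auto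
    define b where "b = p a"
    have ba: "p b = a" "b \<noteq> a" using a less.prems(2) by (auto simp: b_def)
    let ?t = "Transposition.transpose a b"
    define q where "q = ?t \<circ> p"
    have q: "q x = (if x = a then a else if x = b then b else p x)" for x
    proof -
      have "p x = a \<longleftrightarrow> x = b" "p x = b \<longleftrightarrow> x = a" using less.prems(2) unfolding b_def by metis+
      then show ?thesis using ba by (simp add: q_def Transposition.transpose_def b_def)
    qed
    have ab: "a \<in> S" "b \<in> S"
      using less.prems(1) ba a unfolding permutes_def by metis+
    have qS: "q permutes S"
      unfolding q_def by (intro permutes_compose less.prems(1) permutes_swap_id ab)
    have qq: "q (q x) = x" for x
    proof -
      have "p x \<noteq> a \<and> p x \<noteq> b" if "x \<noteq> a" "x \<noteq> b"
        using that less.prems(2) unfolding b_def by metis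
      then show ?thesis
        by (cases "x = a"; cases "x = b") (simp_all only: q less.prems(2) if_True if_False simp_thms)
    qed
    have D: "?D = insert a (insert b {x. q x \<noteq> x})" "a \<notin> insert b {x. q x \<noteq> x}" "b \<notin> {x. q x \<noteq> x}"
      using ba a by (auto simp: q)
    have finq: "finite {x. q x \<noteq> x}" using fin D(1) by (metis finite_insert)
    have card: "card ?D = card {x. q x \<noteq> x} + 2"
      using D finq by simp
    obtain k where k: "card {x. q x \<noteq> x} = 2 * k" "sign q = (-1) ^ k"
      using less.hyps[OF _ qS qq] card by auto
    have "sign q = sign ?t * sign p"
      unfolding q_def using assms(1) less.prems(1)
      by (intro sign_compose permutation_swap_id) (auto simp: permutation_permutes)
    then have "sign p = - sign q" using ba by (simp add: sign_swap_id)
    then show ?thesis using k card by (intro exI[of _ "Suc k"]) simp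
  qed
qed

lemma sign_involution_fixed_points:
  fixes p q :: "'a \<Rightarrow> 'a"
  assumes "finite S" "p permutes S" "\<And>x. p (p x) = x" "q permutes S" "\<And>x. q (q x) = x"
    and fixed: "card {x \<in> S. p x = x} = card {x \<in> S. q x = x} + 2"
  shows "sign p * sign q = -1"
proof -
  have split: "card S = card {x \<in> S. r x = x} + card {x. r x \<noteq> x}" if "r permutes S" for r :: "'a \<Rightarrow> 'a"
  proof -
    have "S = {x \<in> S. r x = x} \<union> {x. r x \<noteq> x}" using that by (auto simp: permutes_def)
    moreover have "{x \<in> S. r x = x} \<inter> {x. r x \<noteq> x} = {}" by auto
    ultimately show ?thesis using assms(1) by (metis card_Un_disjoint finite_Un)
  qed
  obtain k where k: "card {x. p x \<noteq> x} = 2 * k" "sign p = (-1) ^ k"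
    using sign_involution[OF assms(1-3)] by blast
  obtain l where l: "card {x. q x \<noteq> x} = 2 * l" "sign q = (-1) ^ l"
    using sign_involution[OF assms(1) assms(4,5)] by blast
  have "l = Suc k" using split[OF assms(2)] split[OF assms(4)] k l fixed by simp
  then show ?thesis using k l by (simp flip: power_add mult_2)
qed

lemma det_permute_rows_cols:
  assumes A: "A \<in> carrier_mat n n" and p: "p permutes {0..<n}" and q: "q permutes {0..<n}"
  shows "det (mat n n (\<lambda>(i, j). A $$ (p i, q j))) = of_int (sign p * sign q) * det A"
proof -
  let ?B = "mat n n (\<lambda>(i, j). transpose_mat A $$ (q i, j))"
  have B: "?B \<in> carrier_mat n n" by simp
  have "det (mat n n (\<lambda>(i, j). A $$ (p i, q j)))
      = det (mat n n (\<lambda>(i, j). transpose_mat ?B $$ (p i, j)))"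
    using A permutes_in_image[OF p] permutes_in_image[OF q]
    by (intro arg_cong[where f = det] eq_matI) auto
  also have "\<dots> = of_int (sign p) * det (transpose_mat ?B)"
    by (rule det_permute_rows[OF _ p]) simp
  also have "det (transpose_mat ?B) = of_int (sign q) * det A"
    using det_transpose[OF B] det_permute_rows[OF _ q, of "transpose_mat A"] det_transpose[OF A] A
    by simp
  finally show ?thesis by (simp add: mult.assoc)
qed

text \<open>The integers matter here: \<open>det A = - det A\<close> says nothing in characteristic 2.\<close>
lemma det_zero_of_involutions:
  fixes A :: "int mat"
  assumes A: "A \<in> carrier_mat n n"
    and p: "p permutes {0..<n}" "\<And>i. p (p i) = i" and q: "q permutes {0..<n}" "\<And>i. q (q i) = i"
    and inv: "\<And>i j. i < n \<Longrightarrow> j < n \<Longrightarrow> A $$ (p i, q j) = A $$ (i, j)"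
    and fixed: "card {i \<in> {0..<n}. p i = i} = card {i \<in> {0..<n}. q i = i} + 2 \<or>
      card {i \<in> {0..<n}. q i = i} = card {i \<in> {0..<n}. p i = i} + 2"
  shows "det A = 0"
proof -
  have sgn: "sign p * sign q = -1"
    using sign_involution_fixed_points[OF _ p q] sign_involution_fixed_points[OF _ q p] fixed
    by (auto simp: mult.commute)
  have "mat n n (\<lambda>(i, j). A $$ (p i, q j)) = A" using A inv by (intro eq_matI) auto
  then have "det A = - det A"
    using det_permute_rows_cols[OF A p(1) q(1)] sgn by simp
  then show ?thesis by simp
qed

section \<open>The determinant of the binomial matrix\<close>

lemma int_binomial_symmetric: "int_binomial n (n - k) = int_binomial n k"
proof (cases "k < 0 \<or> k > n")
  case False
  then show ?thesis
    using binomial_symmetric[of "nat k" "nat n"] by (auto simp: int_binomial_def nat_diff_distrib)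
qed (auto simp: int_binomial_def)

text \<open>Reversing the columns and reversing each of the two blocks of rows replaces every lower index
  of a binomial coefficient by its complement, because \<open>c = 2 A + M\<close> and \<open>\<gamma> = 2 (A - \<alpha>) + C\<close>.
  Each block has odd size and so a middle row, which is fixed, whereas the number \<open>C + M\<close> of columns
  is even.\<close>
lemma det_N_matrix_symmetric:
  fixes a c \<alpha> \<gamma> s C M :: int
  assumes sum: "a + a + c + \<alpha> + \<alpha> + \<gamma> = 3 * (s + 2)"
    and C: "C = s + 2 - c" "0 \<le> C" "odd C" and M: "M = s + 2 - (\<alpha> + \<alpha> + \<gamma>)" "0 \<le> M" "odd M"
  shows "det (N_matrix a a c \<alpha> \<alpha> \<gamma>) = 0"
proof -
  have s: "s_param a a c \<alpha> \<alpha> \<gamma> = s" using sum by (simp add: s_param_def)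
  obtain C' where C': "C = 2 * int C' + 1"
  proof -
    obtain k where "C = 2 * k + 1" using C(3) by (elim oddE)
    then show thesis using C(2) by (intro that[of "nat k"]) simp
  qed
  obtain M' where M': "M = 2 * int M' + 1"
  proof -
    obtain k where "M = 2 * k + 1" using M(3) by (elim oddE)
    then show thesis using M(2) by (intro that[of "nat k"]) simp
  qed
  define n where "n = nat (C + M)"
  have n: "n = 2 * C' + 2 * M' + 2" using C' M' by (simp add: n_def)
  define p where "p i = (if i < 2 * C' + 1 then 2 * C' - i
    else if i < n then 4 * C' + 2 * M' + 2 - i else i)" for i
  define q where "q j = (if j < n then n - 1 - j else j)" for j
  let ?A = "N_matrix a a c \<alpha> \<alpha> \<gamma>"
  have A: "?A = mat n n (\<lambda>(i, j). if int i < C then int_binomial c (s + 2 - a + int j - int i)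
      else int_binomial \<gamma> (s + 2 - a + C - \<alpha> + int j - int i))"
    unfolding N_matrix_def Let_def s C(1)[symmetric] M(1)[symmetric] n_def
    by (intro eq_matI) (auto simp: algebra_simps)
  have pp: "p (p i) = i" for i by (auto simp: p_def n)
  have qq: "q (q i) = i" for i by (auto simp: q_def)
  have p: "p permutes {0..<n}" by (rule involution_permutes) (auto simp: pp, auto simp: p_def n)
  have q: "q permutes {0..<n}" by (rule involution_permutes) (auto simp: qq, auto simp: q_def)
  show ?thesis
  proof (rule det_zero_of_involutions[OF _ p pp q qq])
    show "?A \<in> carrier_mat n n" by (simp add: A)
    fix i j assume ij: "i < n" "j < n"
    have pn: "p i < n" "q j < n" using ij by (auto simp: p_def q_def n)
    have qj: "int (q j) = C + M - 1 - int j" using ij by (auto simp: q_def n C' M')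
    show "?A $$ (p i, q j) = ?A $$ (i, j)"
    proof (cases "i < 2 * C' + 1")
      case True
      then have pi: "int (p i) = C - 1 - int i" by (auto simp: p_def C')
      have "s + 2 - a + int (q j) - int (p i) = c - (s + 2 - a + int j - int i)"
        using sum C(1) M(1) unfolding pi qj by simp
      from arg_cong[OF this, of "int_binomial c"] have "int_binomial c (s + 2 - a + int (q j) - int (p i))
          = int_binomial c (s + 2 - a + int j - int i)"
        unfolding int_binomial_symmetric .
      moreover have "int i < C" "int (p i) < C" using True C' pi by auto
      ultimately show ?thesis using ij pn by (simp add: A)
    next
      case False
      then have pi: "int (p i) = 2 * C + M - 1 - int i" using ij by (auto simp: p_def C' M' n)
      have "s + 2 - a + C - \<alpha> + int (q j) - int (p i)
          = \<gamma> - (s + 2 - a + C - \<alpha> + int j - int i)"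
        using sum C(1) M(1) unfolding pi qj by simp
      from arg_cong[OF this, of "int_binomial \<gamma>"] have "int_binomial \<gamma> (s + 2 - a + C - \<alpha> + int (q j) - int (p i))
          = int_binomial \<gamma> (s + 2 - a + C - \<alpha> + int j - int i)"
        unfolding int_binomial_symmetric .
      moreover have "\<not> int i < C" "\<not> int (p i) < C" using False C' pi ij M' n by auto
      ultimately show ?thesis using ij pn by (simp add: A)
    qed
  next
    have "{i \<in> {0..<n}. p i = i} = {C', 2 * C' + 1 + M'}"
      by (auto simp: p_def n split: if_splits)
    moreover have "{i \<in> {0..<n}. q i = i} = {}"
      by (auto simp: q_def n split: if_splits) presburger+
    ultimately show "card {i \<in> {0..<n}. p i = i} = card {i \<in> {0..<n}. q i = i} + 2 \<or>
      card {i \<in> {0..<n}. q i = i} = card {i \<in> {0..<n}. p i = i} + 2" by simp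
  qed
qed

section \<open>Singular weighted bipartite graphs\<close>

text \<open>The matrix \<open>W\<close> carries the symmetry and \<open>w\<close> is a weighted version of it, not
  necessarily symmetric, whose Leibniz terms are those of \<open>W\<close> multiplied by a common constant.
  Indexing by abstract finite sets keeps the enumerations that turn \<open>W\<close> and \<open>w\<close> into matrices
  out of the later arguments. The kernel vectors of \<open>w\<close> and of its transpose defeat
  injectivity and surjectivity, respectively.\<close>
lemma singular_of_involutions:
  fixes W :: "'y \<Rightarrow> 'x \<Rightarrow> int" and w :: "'y \<Rightarrow> 'x \<Rightarrow> 'k::field"
  assumes fin: "finite U" "finite V" and card: "card U = card V"
    and rx: "\<And>x. x \<in> U \<Longrightarrow> rx x \<in> U" "\<And>x. rx (rx x) = x"
    and ry: "\<And>y. y \<in> V \<Longrightarrow> ry y \<in> V" "\<And>y. ry (ry y) = y"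
    and inv: "\<And>x y. x \<in> U \<Longrightarrow> y \<in> V \<Longrightarrow> W (ry y) (rx x) = W y x"
    and fixed: "card {x \<in> U. rx x = x} = card {y \<in> V. ry y = y} + 2"
    and scaled: "\<And>g. bij_betw g U V \<Longrightarrow> (\<Prod>x\<in>U. w (g x) x) = D * of_int (\<Prod>x\<in>U. W (g x) x)"
  shows "\<exists>v. (\<exists>x\<in>U. v x \<noteq> 0) \<and> (\<forall>y\<in>V. (\<Sum>x\<in>U. w y x * v x) = 0)" (is ?ker)
    and "\<exists>u. (\<exists>y\<in>V. u y \<noteq> 0) \<and> (\<forall>x\<in>U. (\<Sum>y\<in>V. w y x * u y) = 0)" (is ?coker)
proof -
  define n where "n = card U"
  obtain e where e: "bij_betw e {0..<n} U" using ex_bij_betw_nat_finite[OF fin(1)] n_def by blast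
  obtain f where f: "bij_betw f {0..<n} V" using ex_bij_betw_nat_finite[OF fin(2)] n_def card by metis
  \<comment> \<open>Transport an involution of a set along an enumeration of that set.\<close>
  have conj: "\<exists>p. p permutes {0..<n} \<and> (\<forall>i. p (p i) = i) \<and> (\<forall>i<n. h (p i) = r (h i))
      \<and> card {i \<in> {0..<n}. p i = i} = card {z \<in> Z. r z = z}"
    if h: "bij_betw h {0..<n} Z" and r: "\<And>z. z \<in> Z \<Longrightarrow> r z \<in> Z" "\<And>z. r (r z) = z"
    for h :: "nat \<Rightarrow> 'z" and Z r
  proof -
    define g where "g = inv_into {0..<n} h"
    have g: "g (h i) = i" if "i < n" for i
      using bij_betw_inv_into_left[OF h] that by (simp add: g_def)
    have hg: "h (g z) = z" "g z < n" if "z \<in> Z" for z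
      using bij_betw_inv_into_right[OF h that] bij_betw_apply[OF bij_betw_inv_into[OF h] that]
      by (auto simp: g_def)
    have hZ: "h i \<in> Z" if "i < n" for i using bij_betw_apply[OF h] that by simp
    define p where "p i = (if i < n then g (r (h i)) else i)" for i
    have pn: "p i < n" if "i < n" for i using that by (simp add: p_def hg r hZ)
    have pp: "p (p i) = i" for i by (simp add: p_def hg r hZ g)
    have hp: "h (p i) = r (h i)" if "i < n" for i using that by (simp add: p_def hg r hZ)
    have perm: "p permutes {0..<n}"
      by (rule involution_permutes) (auto simp: pp pn, simp add: p_def)
    have "bij_betw h {i \<in> {0..<n}. p i = i} {z \<in> Z. r z = z}"
    proof (rule bij_betw_byWitness[where f' = g])
      show "g ` {z \<in> Z. r z = z} \<subseteq> {i \<in> {0..<n}. p i = i}"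
        by (auto simp: p_def hg)
      show "h ` {i \<in> {0..<n}. p i = i} \<subseteq> {z \<in> Z. r z = z}"
        using hp hZ by fastforce
    qed (auto simp: g hg)
    then show ?thesis using perm pp hp bij_betw_same_card by blast
  qed
  obtain q where q: "q permutes {0..<n}" "\<And>i. q (q i) = i" "\<And>i. i < n \<Longrightarrow> e (q i) = rx (e i)"
      "card {i \<in> {0..<n}. q i = i} = card {x \<in> U. rx x = x}"
    using conj[OF e rx] by blast
  obtain p where p: "p permutes {0..<n}" "\<And>i. p (p i) = i" "\<And>i. i < n \<Longrightarrow> f (p i) = ry (f i)"
      "card {i \<in> {0..<n}. p i = i} = card {y \<in> V. ry y = y}"
    using conj[OF f ry] by blast
  have eU: "e i \<in> U" and fV: "f i \<in> V" if "i < n" for i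
    using bij_betw_apply[OF e] bij_betw_apply[OF f] that by auto
  define A where "A = mat n n (\<lambda>(i, j). W (f i) (e j))"
  define B where "B = mat n n (\<lambda>(i, j). w (f i) (e j))"
  have carr: "A \<in> carrier_mat n n" "B \<in> carrier_mat n n" by (auto simp: A_def B_def)
  have "det A = 0"
  proof (rule det_zero_of_involutions[OF carr(1) p(1,2) q(1,2)])
    fix i j assume ij: "i < n" "j < n"
    moreover have "p i < n" "q j < n"
      using permutes_in_image[OF p(1), of i] permutes_in_image[OF q(1), of j] ij by auto
    ultimately show "A $$ (p i, q j) = A $$ (i, j)"
      by (simp add: A_def p(3) q(3) inv eU fV)
  qed (use fixed p(4) q(4) in simp)
  moreover have "det B = D * of_int (det A)"
  proof -
    have leib: "(\<Prod>i = 0..<n. B $$ (i, r i)) = D * of_int (\<Prod>i = 0..<n. A $$ (i, r i))"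
      if r: "r permutes {0..<n}" for r
    proof -
      have rn: "r i < n" if "i < n" for i using permutes_in_image[OF r, of i] that by auto
      have er: "bij_betw (e \<circ> r) {0..<n} U"
        using bij_betw_trans[OF permutes_imp_bij[OF r] e] .
      \<comment> \<open>The permutation \<open>r\<close>, read as a perfect matching between \<open>U\<close> and \<open>V\<close>.\<close>
      define g where "g = f \<circ> inv_into {0..<n} (e \<circ> r)"
      have g: "bij_betw g U V"
        unfolding g_def by (rule bij_betw_trans[OF bij_betw_inv_into[OF er] f])
      have ger: "g (e (r i)) = f i" if "i < n" for i
        using bij_betw_inv_into_left[OF er] that by (simp add: g_def)
      have "(\<Prod>i = 0..<n. B $$ (i, r i)) = (\<Prod>i = 0..<n. w (g ((e \<circ> r) i)) ((e \<circ> r) i))"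
        by (intro prod.cong) (auto simp: B_def rn ger)
      also have "\<dots> = (\<Prod>x\<in>U. w (g x) x)" by (rule prod.reindex_bij_betw[OF er])
      also have "\<dots> = D * of_int (\<Prod>x\<in>U. W (g x) x)" by (rule scaled[OF g])
      also have "(\<Prod>x\<in>U. W (g x) x) = (\<Prod>i = 0..<n. W (g ((e \<circ> r) i)) ((e \<circ> r) i))"
        by (rule prod.reindex_bij_betw[OF er, symmetric])
      also have "\<dots> = (\<Prod>i = 0..<n. A $$ (i, r i))"
        by (intro prod.cong) (auto simp: A_def rn ger)
      finally show ?thesis .
    qed
    show ?thesis
      unfolding det_def'[OF carr(1)] det_def'[OF carr(2)] of_int_sum sum_distrib_left
      by (intro sum.cong) (simp_all add: leib sign_def)
  qed
  ultimately have det: "det B = 0" by simp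
  have sumU: "(\<Sum>j = 0..<n. h (e j)) = (\<Sum>x\<in>U. h x)" for h :: "'x \<Rightarrow> 'k"
    by (rule sum.reindex_bij_betw[OF e])
  have sumV: "(\<Sum>j = 0..<n. h (f j)) = (\<Sum>y\<in>V. h y)" for h :: "'y \<Rightarrow> 'k"
    by (rule sum.reindex_bij_betw[OF f])
  show ?ker
  proof -
    obtain v where v: "v \<in> carrier_vec n" "v \<noteq> 0\<^sub>v n" "B *\<^sub>v v = 0\<^sub>v n"
      using det det_0_iff_vec_prod_zero_field[OF carr(2)] by blast
    define v' where "v' = (\<lambda>x. v $ inv_into {0..<n} e x)"
    have v': "v' (e j) = v $ j" if "j < n" for j
      using bij_betw_inv_into_left[OF e] that by (simp add: v'_def)
    obtain j where j: "j < n" "v $ j \<noteq> 0" using v(1,2) by (metis carrier_vecD eq_vecI index_zero_vec)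
    have "(\<Sum>x\<in>U. w y x * v' x) = 0" if "y \<in> V" for y
    proof -
      obtain i where i: "i < n" "y = f i" using f \<open>y \<in> V\<close> by (auto simp: bij_betw_def)
      have "(B *\<^sub>v v) $ i = (\<Sum>j = 0..<n. w (f i) (e j) * v' (e j))"
        using v(1) i(1) by (auto simp: B_def scalar_prod_def v' intro!: sum.cong)
      then show ?thesis using v(3) i sumU[of "\<lambda>x. w y x * v' x"] by simp
    qed
    then show ?thesis using j v' eU by metis
  qed
  show ?coker
  proof -
    have "transpose_mat B \<in> carrier_mat n n" "det (transpose_mat B) = 0"
      using det det_transpose[OF carr(2)] carr(2) by auto
    then obtain v where v: "v \<in> carrier_vec n" "v \<noteq> 0\<^sub>v n" "transpose_mat B *\<^sub>v v = 0\<^sub>v n"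
      using det_0_iff_vec_prod_zero_field by blast
    define v' where "v' = (\<lambda>x. v $ inv_into {0..<n} f x)"
    have v': "v' (f j) = v $ j" if "j < n" for j
      using bij_betw_inv_into_left[OF f] that by (simp add: v'_def)
    obtain j where j: "j < n" "v $ j \<noteq> 0" using v(1,2) by (metis carrier_vecD eq_vecI index_zero_vec)
    have "(\<Sum>y\<in>V. w y x * v' y) = 0" if "x \<in> U" for x
    proof -
      obtain i where i: "i < n" "x = e i" using e \<open>x \<in> U\<close> by (auto simp: bij_betw_def)
      have "(transpose_mat B *\<^sub>v v) $ i = (\<Sum>j = 0..<n. w (f j) (e i) * v' (f j))"
        using v(1) i(1) by (auto simp: B_def scalar_prod_def v' intro!: sum.cong)
      then show ?thesis using v(3) i sumV[of "\<lambda>y. w y x * v' y"] by simp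
    qed
    then show ?thesis using j v' fV by metis
  qed
qed

section \<open>Monomials outside the ideal\<close>

instance var3 :: finite
proof
  have "(UNIV :: var3 set) = {VX, VY, VZ}" using var3.exhaust by auto
  then show "finite (UNIV :: var3 set)" by (metis finite.emptyI finite_insert)
qed

definition exps :: "nat \<Rightarrow> nat \<Rightarrow> nat \<Rightarrow> var3 \<Rightarrow>\<^sub>0 nat" where
  "exps i j k = Poly_Mapping.single VX i + Poly_Mapping.single VY j + Poly_Mapping.single VZ k"

lemma lookup_exps [simp]:
  "Poly_Mapping.lookup (exps i j k) VX = i"
  "Poly_Mapping.lookup (exps i j k) VY = j"
  "Poly_Mapping.lookup (exps i j k) VZ = k"
  by (simp_all add: exps_def lookup_add lookup_single)

lemma exps_eqI:
  assumes "Poly_Mapping.lookup m VX = Poly_Mapping.lookup m' VX"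
    "Poly_Mapping.lookup m VY = Poly_Mapping.lookup m' VY"
    "Poly_Mapping.lookup m VZ = Poly_Mapping.lookup m' VZ"
  shows "m = (m' :: var3 \<Rightarrow>\<^sub>0 nat)"
  using assms by (intro poly_mapping_eqI) (metis var3.exhaust)

lemma exps_lookup:
  "exps (Poly_Mapping.lookup m VX) (Poly_Mapping.lookup m VY) (Poly_Mapping.lookup m VZ) = m"
  by (rule exps_eqI) simp_all

definition in_mon_ideal :: "nat \<Rightarrow> nat \<Rightarrow> nat \<Rightarrow> nat \<Rightarrow> nat \<Rightarrow> nat \<Rightarrow> (var3 \<Rightarrow>\<^sub>0 nat) \<Rightarrow> bool" where
  "in_mon_ideal a b c \<alpha> \<beta> \<gamma> m \<longleftrightarrow>
    a \<le> Poly_Mapping.lookup m VX \<or> b \<le> Poly_Mapping.lookup m VY \<or> c \<le> Poly_Mapping.lookup m VZ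
    \<or> \<alpha> \<le> Poly_Mapping.lookup m VX \<and> \<beta> \<le> Poly_Mapping.lookup m VY \<and> \<gamma> \<le> Poly_Mapping.lookup m VZ"

definition std_monomials :: "nat \<Rightarrow> nat \<Rightarrow> nat \<Rightarrow> nat \<Rightarrow> nat \<Rightarrow> nat \<Rightarrow> nat \<Rightarrow> (var3 \<Rightarrow>\<^sub>0 nat) set" where
  "std_monomials a b c \<alpha> \<beta> \<gamma> d = {m. \<not> in_mon_ideal a b c \<alpha> \<beta> \<gamma> m \<and> exp_degree m = d}"

lemma finite_std_monomials: "finite (std_monomials a b c \<alpha> \<beta> \<gamma> d)"
proof (rule finite_subset)
  show "std_monomials a b c \<alpha> \<beta> \<gamma> d \<subseteq> (\<lambda>(i, j, k). exps i j k) ` ({..d} \<times> {..d} \<times> {..d})"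
  proof
    fix m assume "m \<in> std_monomials a b c \<alpha> \<beta> \<gamma> d"
    moreover have "m = exps (Poly_Mapping.lookup m VX) (Poly_Mapping.lookup m VY) (Poly_Mapping.lookup m VZ)"
      by (simp add: exps_lookup)
    ultimately show "m \<in> (\<lambda>(i, j, k). exps i j k) ` ({..d} \<times> {..d} \<times> {..d})"
      by (intro image_eqI[where x = "(Poly_Mapping.lookup m VX, Poly_Mapping.lookup m VY, Poly_Mapping.lookup m VZ)"])
        (auto simp: std_monomials_def exp_degree_def)
  qed
qed simp

text \<open>Multiplication by \<open>z\<close> is a bijection from the monomials of degree \<open>d\<close> that it keeps outside the
  ideal to the monomials of degree \<open>d + 1\<close> outside the ideal that are divisible by \<open>z\<close>. A condition \<open>Q\<close> on the exponents of \<open>x\<close> and \<open>y\<close> is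
  preserved; it is used with \<open>Q\<close> always true, for the dimensions, and with equality, for the
  monomials fixed by exchanging \<open>x\<close> and \<open>y\<close>.\<close>
lemma card_std_monomials_shift:
  fixes a b c \<alpha> \<beta> \<gamma> d :: nat and Q :: "nat \<Rightarrow> nat \<Rightarrow> bool"
  defines "S \<equiv> std_monomials a b c \<alpha> \<beta> \<gamma>"
    and "R \<equiv> \<lambda>m. Q (Poly_Mapping.lookup m VX) (Poly_Mapping.lookup m VY)"
  shows "card {m \<in> S d. R m} + card {m \<in> S (Suc d). Poly_Mapping.lookup m VZ = 0 \<and> R m}
    = card {m \<in> S (Suc d). R m} + card {m \<in> S d. in_mon_ideal a b c \<alpha> \<beta> \<gamma> (exps 0 0 1 + m) \<and> R m}"
proof -
  let ?z = "\<lambda>m. exps 0 0 1 + m"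
  have fin: "finite (S d')" for d' by (simp add: S_def finite_std_monomials)
  have "bij_betw ?z {m \<in> S d. \<not> in_mon_ideal a b c \<alpha> \<beta> \<gamma> (?z m) \<and> R m}
      {m \<in> S (Suc d). Poly_Mapping.lookup m VZ \<noteq> 0 \<and> R m}"
  proof (rule bij_betw_byWitness[where f' = "\<lambda>m. exps (Poly_Mapping.lookup m VX) (Poly_Mapping.lookup m VY)
        (Poly_Mapping.lookup m VZ - 1)"])
    show "?z ` {m \<in> S d. \<not> in_mon_ideal a b c \<alpha> \<beta> \<gamma> (?z m) \<and> R m}
        \<subseteq> {m \<in> S (Suc d). Poly_Mapping.lookup m VZ \<noteq> 0 \<and> R m}"
      by (auto simp: S_def std_monomials_def exp_degree_def lookup_add R_def)
    show "(\<lambda>m. exps (Poly_Mapping.lookup m VX) (Poly_Mapping.lookup m VY) (Poly_Mapping.lookup m VZ - 1)) `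
        {m \<in> S (Suc d). Poly_Mapping.lookup m VZ \<noteq> 0 \<and> R m}
        \<subseteq> {m \<in> S d. \<not> in_mon_ideal a b c \<alpha> \<beta> \<gamma> (?z m) \<and> R m}"
      by (auto simp: S_def std_monomials_def exp_degree_def lookup_add R_def in_mon_ideal_def)
  qed (auto intro!: exps_eqI simp: lookup_add)
  then have "card {m \<in> S d. \<not> in_mon_ideal a b c \<alpha> \<beta> \<gamma> (?z m) \<and> R m}
      = card {m \<in> S (Suc d). Poly_Mapping.lookup m VZ \<noteq> 0 \<and> R m}"
    by (rule bij_betw_same_card)
  moreover have "card {m \<in> S d'. R m} = card {m \<in> S d'. P m \<and> R m} + card {m \<in> S d'. \<not> P m \<and> R m}"
    for d' and P :: "(var3 \<Rightarrow>\<^sub>0 nat) \<Rightarrow> bool"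
  proof -
    have "{m \<in> S d'. R m} = {m \<in> S d'. P m \<and> R m} \<union> {m \<in> S d'. \<not> P m \<and> R m}" by auto
    then show ?thesis using fin[of d'] by (simp add: card_Un_disjoint disjoint_iff)
  qed
  note this[of d "\<lambda>m. in_mon_ideal a b c \<alpha> \<beta> \<gamma> (?z m)"] this[of "Suc d" "\<lambda>m. Poly_Mapping.lookup m VZ = 0"]
  ultimately show ?thesis by linarith
qed

text \<open>The parities allow the substitution \<open>C = 2 p + 1\<close>, \<open>M = 2 q + 1\<close>, \<open>\<gamma> = 2 G + 1\<close>, and all other
  parameters are then expressed by \<open>A\<close>, \<open>p\<close>, \<open>q\<close>, \<open>G\<close>, which avoids subtraction of natural numbers. The
  condition \<open>C \<le> 2 \<alpha>\<close> becomes \<open>G < A\<close>.\<close>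

context
  fixes a c \<alpha> \<gamma> A G p q s :: nat
  assumes a: "a = A + 2 * p + 2 * q + 2" and c: "c = 2 * A + 2 * q + 1"
    and \<gamma>: "\<gamma> = 2 * G + 1" and \<alpha>: "\<alpha> + G = A + p" and G: "G < A" and s: "s = 2 * A + 2 * p + 2 * q"
begin

text \<open>Multiplication by \<open>z\<close> leads into the ideal in two ways: through \<open>z ^ c\<close>, on a row of
  \<open>C\<close> monomials, or through \<open>x ^ \<alpha> * y ^ \<alpha> * z ^ \<gamma>\<close>, on a row of \<open>M\<close> monomials along the puncture.\<close>
lemma top_monomials:
  "{m \<in> std_monomials a a c \<alpha> \<alpha> \<gamma> s. in_mon_ideal a a c \<alpha> \<alpha> \<gamma> (exps 0 0 1 + m)}
    = (\<lambda>i. exps i (2 * p - i) (2 * A + 2 * q)) ` {..2 * p}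
      \<union> (\<lambda>i. exps i (2 * \<alpha> + 2 * q - i) (2 * G)) ` {\<alpha>..\<alpha> + 2 * q}" (is "?L = ?R1 \<union> ?R2")
proof
  show "?R1 \<union> ?R2 \<subseteq> ?L"
    using a c \<gamma> \<alpha> G s by (auto simp: std_monomials_def exp_degree_def lookup_add in_mon_ideal_def)
  show "?L \<subseteq> ?R1 \<union> ?R2"
  proof
    fix m assume m: "m \<in> ?L"
    let ?x = "Poly_Mapping.lookup m VX" and ?y = "Poly_Mapping.lookup m VY" and ?z = "Poly_Mapping.lookup m VZ"
    have std: "?x + ?y + ?z = s" "?x < a" "?y < a" "?z < c" "\<not> (\<alpha> \<le> ?x \<and> \<alpha> \<le> ?y \<and> \<gamma> \<le> ?z)"
      and top: "c \<le> Suc ?z \<or> \<alpha> \<le> ?x \<and> \<alpha> \<le> ?y \<and> \<gamma> \<le> Suc ?z"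
      using m by (auto simp: std_monomials_def exp_degree_def lookup_add in_mon_ideal_def)
    show "m \<in> ?R1 \<union> ?R2"
    proof (cases "c \<le> Suc ?z")
      case True
      then have "m = exps ?x (2 * p - ?x) (2 * A + 2 * q)" "?x \<le> 2 * p"
        using std c s by (auto intro!: exps_eqI)
      then show ?thesis by blast
    next
      case False
      then have "m = exps ?x (2 * \<alpha> + 2 * q - ?x) (2 * G)" "?x \<in> {\<alpha>..\<alpha> + 2 * q}"
        using std top \<gamma> \<alpha> s by (auto intro!: exps_eqI)
      then show ?thesis by blast
    qed
  qed
qed

lemma bottom_monomials:
  "{m \<in> std_monomials a a c \<alpha> \<alpha> \<gamma> (Suc s). Poly_Mapping.lookup m VZ = 0}
    = (\<lambda>i. exps i (Suc s - i) 0) ` {A..A + 2 * p + 2 * q + 1}" (is "?L = ?R")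
proof
  show "?R \<subseteq> ?L"
    using a c \<gamma> s by (auto simp: std_monomials_def exp_degree_def in_mon_ideal_def)
  show "?L \<subseteq> ?R"
  proof
    fix m assume m: "m \<in> ?L"
    let ?x = "Poly_Mapping.lookup m VX"
    have "m = exps ?x (Suc s - ?x) 0" "?x \<in> {A..A + 2 * p + 2 * q + 1}"
      using m a s by (auto simp: std_monomials_def exp_degree_def in_mon_ideal_def intro!: exps_eqI)
    then show "m \<in> ?R" by blast
  qed
qed

lemma card_std_monomials_eq:
  "card (std_monomials a a c \<alpha> \<alpha> \<gamma> s) = card (std_monomials a a c \<alpha> \<alpha> \<gamma> (Suc s))"
proof -
  have inj: "inj_on (\<lambda>i. exps i (h i) k) T" for h :: "nat \<Rightarrow> nat" and k T
    by (rule inj_onI) (metis lookup_exps(1))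
  have "card {m \<in> std_monomials a a c \<alpha> \<alpha> \<gamma> s. in_mon_ideal a a c \<alpha> \<alpha> \<gamma> (exps 0 0 1 + m)}
      = (2 * p + 1) + (2 * q + 1)"
  proof -
    have "(\<lambda>i. exps i (2 * p - i) (2 * A + 2 * q)) ` {..2 * p}
        \<inter> (\<lambda>i. exps i (2 * \<alpha> + 2 * q - i) (2 * G)) ` {\<alpha>..\<alpha> + 2 * q} = {}"
      using G by (auto dest!: arg_cong[where f = "\<lambda>m. Poly_Mapping.lookup m VZ"])
    then show ?thesis unfolding top_monomials by (simp add: card_Un_disjoint card_image inj)
  qed
  moreover have "card {m \<in> std_monomials a a c \<alpha> \<alpha> \<gamma> (Suc s). Poly_Mapping.lookup m VZ = 0}
      = 2 * p + 2 * q + 2"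
    unfolding bottom_monomials by (simp add: card_image inj)
  ultimately show ?thesis
    using card_std_monomials_shift[of a a c \<alpha> \<alpha> \<gamma> s "\<lambda>_ _. True"] by simp
qed

text \<open>Each of the two rows of odd length has a middle monomial, symmetric in \<open>x\<close> and \<open>y\<close>; the row of
  monomials of odd degree \<open>s + 1\<close> without \<open>z\<close> has none.\<close>
lemma card_symmetric_std_monomials:
  "card {m \<in> std_monomials a a c \<alpha> \<alpha> \<gamma> s. Poly_Mapping.lookup m VX = Poly_Mapping.lookup m VY}
    = card {m \<in> std_monomials a a c \<alpha> \<alpha> \<gamma> (Suc s). Poly_Mapping.lookup m VX = Poly_Mapping.lookup m VY} + 2"
proof -
  let ?sym = "\<lambda>m. Poly_Mapping.lookup m VX = Poly_Mapping.lookup m VY"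
  have "{m \<in> std_monomials a a c \<alpha> \<alpha> \<gamma> s. in_mon_ideal a a c \<alpha> \<alpha> \<gamma> (exps 0 0 1 + m) \<and> ?sym m}
      = {m \<in> {m \<in> std_monomials a a c \<alpha> \<alpha> \<gamma> s. in_mon_ideal a a c \<alpha> \<alpha> \<gamma> (exps 0 0 1 + m)}. ?sym m}"
    by auto
  also have "\<dots> = {exps p p (2 * A + 2 * q), exps (\<alpha> + q) (\<alpha> + q) (2 * G)}"
  proof -
    let ?R1 = "(\<lambda>i. exps i (2 * p - i) (2 * A + 2 * q)) ` {..2 * p}"
    let ?R2 = "(\<lambda>i. exps i (2 * \<alpha> + 2 * q - i) (2 * G)) ` {\<alpha>..\<alpha> + 2 * q}"
    have 1: "exps p p (2 * A + 2 * q) \<in> ?R1"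
      by (rule image_eqI[of _ _ p]) (auto intro: exps_eqI)
    have 2: "exps (\<alpha> + q) (\<alpha> + q) (2 * G) \<in> ?R2"
      by (rule image_eqI[of _ _ "\<alpha> + q"]) (auto intro: exps_eqI)
    have 3: "m = exps p p (2 * A + 2 * q)" if "m \<in> ?R1" "?sym m" for m
      using that by (intro exps_eqI) auto
    have 4: "m = exps (\<alpha> + q) (\<alpha> + q) (2 * G)" if "m \<in> ?R2" "?sym m" for m
      using that by (intro exps_eqI) auto
    show ?thesis unfolding top_monomials
    proof (rule subset_antisym)
      show "{m \<in> ?R1 \<union> ?R2. ?sym m} \<subseteq> {exps p p (2 * A + 2 * q), exps (\<alpha> + q) (\<alpha> + q) (2 * G)}"
        using 3 4 by blast
      show "{exps p p (2 * A + 2 * q), exps (\<alpha> + q) (\<alpha> + q) (2 * G)} \<subseteq> {m \<in> ?R1 \<union> ?R2. ?sym m}"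
        using 1 2 by (simp only: insert_subset empty_subsetI mem_Collect_eq Un_iff lookup_exps simp_thms)
    qed
  qed
  also have "card \<dots> = 2"
    using G by (auto simp: card_insert_if dest!: arg_cong[where f = "\<lambda>m. Poly_Mapping.lookup m VZ"])
  finally have top: "card {m \<in> std_monomials a a c \<alpha> \<alpha> \<gamma> s.
      in_mon_ideal a a c \<alpha> \<alpha> \<gamma> (exps 0 0 1 + m) \<and> ?sym m} = 2" .
  have "{m \<in> std_monomials a a c \<alpha> \<alpha> \<gamma> (Suc s). Poly_Mapping.lookup m VZ = 0 \<and> ?sym m} = {}"
  proof -
    have "?sym m \<Longrightarrow> Poly_Mapping.lookup m VZ = 0 \<Longrightarrow> exp_degree m \<noteq> Suc s" for m
      unfolding exp_degree_def s by presburger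
    then show ?thesis by (auto simp: std_monomials_def)
  qed
  then have bottom: "card {m \<in> std_monomials a a c \<alpha> \<alpha> \<gamma> (Suc s). Poly_Mapping.lookup m VZ = 0 \<and> ?sym m} = 0"
    by (simp only: card.empty)
  show ?thesis
    using card_std_monomials_shift[of a a c \<alpha> \<alpha> \<gamma> s "(=)"] top bottom by simp
qed

end

section \<open>Membership in the ideal\<close>

lemma Var_power: "(Var v ^ n :: 'k::field poly3) = Poly_Mapping.single (Poly_Mapping.single v n) 1"
proof (induction n)
  case (Suc n)
  have "Poly_Mapping.single v 1 + Poly_Mapping.single v n = Poly_Mapping.single v (Suc n)"
    by (simp flip: single_add)
  with Suc show ?case by (simp add: Var_def mult_single)
qed simp

lemma in_mon_ideal_add: "in_mon_ideal a b c \<alpha> \<beta> \<gamma> m \<Longrightarrow> in_mon_ideal a b c \<alpha> \<beta> \<gamma> (l + m)"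
  by (auto simp: in_mon_ideal_def lookup_add)

lemma ring_of_type_algebra_simps [simp]:
  "carrier (ring_of_type_algebra :: 'r::comm_ring_1 ring) = UNIV"
  "p \<otimes>\<^bsub>(ring_of_type_algebra :: 'r ring)\<^esub> q = p * q"
  "p \<oplus>\<^bsub>(ring_of_type_algebra :: 'r ring)\<^esub> q = p + q"
  "\<zero>\<^bsub>(ring_of_type_algebra :: 'r ring)\<^esub> = 0"
  by (simp_all add: ring_of_type_algebra_def)

lemma a_inv_ring_of_type_algebra: "\<ominus>\<^bsub>ring_of_type_algebra\<^esub> (p :: 'r::comm_ring_1) = - p"
proof -
  interpret ring "ring_of_type_algebra :: 'r ring" by (rule ring_from_type_algebra)
  show ?thesis by (rule minus_equality) simp_all
qed

lemma ideal_ideal_I: "ideal (ideal_I a b c \<alpha> \<beta> \<gamma> :: 'k::field poly3 set) poly3_ring"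
proof -
  interpret ring "poly3_ring :: 'k poly3 ring" by (rule ring_from_type_algebra)
  show ?thesis unfolding ideal_I_def by (rule genideal_ideal) simp
qed

lemma ideal_monomial_support:
  "ideal {p :: 'k::field poly3. \<forall>m \<in> Poly_Mapping.keys p. in_mon_ideal a b c \<alpha> \<beta> \<gamma> m} poly3_ring"
    (is "ideal ?J _")
proof -
  interpret ring "poly3_ring :: 'k poly3 ring" by (rule ring_from_type_algebra)
  have mult: "p * q \<in> ?J" if "q \<in> ?J" for p q :: "'k poly3"
  proof -
    have "in_mon_ideal a b c \<alpha> \<beta> \<gamma> m" if m: "m \<in> Poly_Mapping.keys (p * q)" for m
    proof -
      obtain m1 m2 where "m2 \<in> Poly_Mapping.keys q" "m = m1 + m2"
        using keys_mult[of p q] m by blast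
      then show ?thesis using \<open>q \<in> ?J\<close> by (simp add: in_mon_ideal_add)
    qed
    then show ?thesis by simp
  qed
  show ?thesis
  proof (rule idealI[OF ring_from_type_algebra])
    show "subgroup ?J (add_monoid poly3_ring)"
    proof (rule add.subgroupI)
      show "?J \<noteq> {}" proof -
        have "0 \<in> ?J" by simp
        then show ?thesis by blast
      qed
      show "\<ominus>\<^bsub>poly3_ring\<^esub> p \<in> ?J" if "p \<in> ?J" for p
        using that by (simp add: a_inv_ring_of_type_algebra in_keys_iff)
      show "p \<oplus>\<^bsub>poly3_ring\<^esub> q \<in> ?J" if "p \<in> ?J" "q \<in> ?J" for p q
      proof -
        have "in_mon_ideal a b c \<alpha> \<beta> \<gamma> m" if m: "m \<in> Poly_Mapping.keys (p + q)" for m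
          using keys_add[of p q] m \<open>p \<in> ?J\<close> \<open>q \<in> ?J\<close> by blast
        then show ?thesis by simp
      qed
    qed simp
  next
    fix q p :: "'k poly3" assume q: "q \<in> ?J"
    show "p \<otimes>\<^bsub>poly3_ring\<^esub> q \<in> ?J" using mult[OF q, of p] by simp
    show "q \<otimes>\<^bsub>poly3_ring\<^esub> p \<in> ?J" using mult[OF q, of p] by (simp add: mult.commute)
  qed
qed

text \<open>A monomial ideal consists of the polynomials all of whose monomials lie in it, because the
  polynomials of the latter kind form an ideal and are sums of multiples of the generators.\<close>
lemma mem_ideal_I_iff:
  fixes P :: "'k::field poly3"
  shows "P \<in> ideal_I a b c \<alpha> \<beta> \<gamma> \<longleftrightarrow>
    (\<forall>m \<in> Poly_Mapping.keys P. in_mon_ideal (nat a) (nat b) (nat c) (nat \<alpha>) (nat \<beta>) (nat \<gamma>) m)"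
    (is "_ \<longleftrightarrow> (\<forall>m \<in> _. ?P m)")
proof
  let ?R = "poly3_ring :: 'k poly3 ring"
  let ?gens = "{Var VX ^ nat a, Var VY ^ nat b, Var VZ ^ nat c,
      Var VX ^ nat \<alpha> * Var VY ^ nat \<beta> * Var VZ ^ nat \<gamma>} :: 'k poly3 set"
  interpret ring ?R by (rule ring_from_type_algebra)
  have gens: "?gens = (\<lambda>g. Poly_Mapping.single g 1) ` {exps (nat a) 0 0, exps 0 (nat b) 0, exps 0 0 (nat c),
      exps (nat \<alpha>) (nat \<beta>) (nat \<gamma>)}"
    by (simp add: Var_power mult_single exps_def)
  have "?gens \<subseteq> {p. \<forall>m \<in> Poly_Mapping.keys p. ?P m}"
    unfolding gens by (auto simp: in_mon_ideal_def)
  then have sub: "ideal_I a b c \<alpha> \<beta> \<gamma> \<subseteq> {p :: 'k poly3. \<forall>m \<in> Poly_Mapping.keys p. ?P m}"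
    unfolding ideal_I_def by (rule genideal_minimal[OF ideal_monomial_support])
  show "\<forall>m \<in> Poly_Mapping.keys P. ?P m" if "P \<in> ideal_I a b c \<alpha> \<beta> \<gamma>"
    using subsetD[OF sub that] by (simp only: mem_Collect_eq)
  interpret I: ideal "ideal_I a b c \<alpha> \<beta> \<gamma>" ?R by (rule ideal_ideal_I)
  have gens_in: "?gens \<subseteq> ideal_I a b c \<alpha> \<beta> \<gamma>"
    unfolding ideal_I_def by (rule genideal_self) simp
  have mult_in: "Poly_Mapping.single (l + g) k \<in> ideal_I a b c \<alpha> \<beta> \<gamma>"
    if "Poly_Mapping.single g 1 \<in> ?gens" for l g and k :: 'k
  proof -
    have "Poly_Mapping.single l k * Poly_Mapping.single g 1 \<in> ideal_I a b c \<alpha> \<beta> \<gamma>"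
      using I.I_l_closed[of "Poly_Mapping.single g 1" "Poly_Mapping.single l k"] that gens_in by auto
    then show ?thesis by (simp add: mult_single)
  qed
  have single_in: "Poly_Mapping.single m k \<in> ideal_I a b c \<alpha> \<beta> \<gamma>" if "?P m" for m and k :: 'k
  proof -
    let ?x = "Poly_Mapping.lookup m VX" and ?y = "Poly_Mapping.lookup m VY" and ?z = "Poly_Mapping.lookup m VZ"
    have "\<exists>g \<in> {exps (nat a) 0 0, exps 0 (nat b) 0, exps 0 0 (nat c), exps (nat \<alpha>) (nat \<beta>) (nat \<gamma>)}.
        Poly_Mapping.lookup g VX \<le> ?x \<and> Poly_Mapping.lookup g VY \<le> ?y \<and> Poly_Mapping.lookup g VZ \<le> ?z"
      using that unfolding in_mon_ideal_def by auto
    then obtain g where g: "Poly_Mapping.single g 1 \<in> ?gens"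
      "Poly_Mapping.lookup g VX \<le> ?x" "Poly_Mapping.lookup g VY \<le> ?y" "Poly_Mapping.lookup g VZ \<le> ?z"
      unfolding gens by blast
    have "m = exps (?x - Poly_Mapping.lookup g VX) (?y - Poly_Mapping.lookup g VY)
        (?z - Poly_Mapping.lookup g VZ) + g"
      using g by (intro exps_eqI) (simp_all add: lookup_add)
    then show ?thesis using mult_in[OF g(1)] by metis
  qed
  assume P: "\<forall>m \<in> Poly_Mapping.keys P. ?P m"
  have "(\<Sum>m\<in>T. Poly_Mapping.single m (Poly_Mapping.lookup P m)) \<in> ideal_I a b c \<alpha> \<beta> \<gamma>"
    if "finite T" "T \<subseteq> Poly_Mapping.keys P" for T
    using that
  proof (induction rule: finite_induct)
    case empty
    then show ?case using I.zero_closed by simp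
  next
    case (insert m T)
    then show ?case using I.a_closed[OF single_in] P by simp
  qed
  moreover have "P = (\<Sum>m\<in>Poly_Mapping.keys P. Poly_Mapping.single m (Poly_Mapping.lookup P m))"
    by (rule poly_mapping_eqI)
      (simp add: lookup_sum lookup_single when_def in_keys_iff)
  ultimately show "P \<in> ideal_I a b c \<alpha> \<beta> \<gamma>" by (metis finite_keys order_refl)
qed

section \<open>Multiplication by a linear form\<close>

text \<open>The matrix entry, in row \<open>y\<close> and column \<open>x\<close>, of multiplication by the linear form with
  coefficients \<open>l\<close>.  The ring is kept general because the matrix is needed over the
  integers, with all coefficients 1, and over the field.\<close>
definition linear_weight :: "(var3 \<Rightarrow> 'r::comm_ring_1) \<Rightarrow> (var3 \<Rightarrow>\<^sub>0 nat) \<Rightarrow> (var3 \<Rightarrow>\<^sub>0 nat) \<Rightarrow> 'r" where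
  "linear_weight l y x = (\<Sum>v\<in>UNIV. if y = Poly_Mapping.single v 1 + x then l v else 0)"

lemma lookup_times_single:
  fixes q :: "'k::field poly3"
  assumes "finite S" "\<And>x. y = t + x \<Longrightarrow> x \<in> S"
  shows "Poly_Mapping.lookup (Poly_Mapping.single t k * q) y
    = (\<Sum>x\<in>S. if y = t + x then k * Poly_Mapping.lookup q x else 0)"
proof -
  have "Poly_Mapping.lookup (Poly_Mapping.single t k * q) y
      = k * (\<Sum>x. Poly_Mapping.lookup q x when y = t + x)"
    by (simp add: lookup_mult lookup_single when_mult)
  also have "(\<Sum>x. Poly_Mapping.lookup q x when y = t + x)
      = (\<Sum>x\<in>S. Poly_Mapping.lookup q x when y = t + x)"
    using assms by (intro Sum_any.expand_superset) auto
  also have "k * \<dots> = (\<Sum>x\<in>S. if y = t + x then k * Poly_Mapping.lookup q x else 0)"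
    by (auto simp: sum_distrib_left when_def intro!: sum.cong)
  finally show ?thesis .
qed

lemma exp_degree_add: "exp_degree (m + m') = exp_degree m + exp_degree m'"
  by (simp add: exp_degree_def lookup_add)

lemma exp_degree_single: "exp_degree (Poly_Mapping.single v n) = n"
  by (cases v) (simp_all add: exp_degree_def lookup_single)

lemma linear_form_eq:
  assumes "l \<in> forms 1"
  shows "l = (\<Sum>v\<in>UNIV. Poly_Mapping.single (Poly_Mapping.single v 1)
      (Poly_Mapping.lookup l (Poly_Mapping.single v 1) :: 'k::field))"
proof (rule poly_mapping_eqI)
  fix m :: "var3 \<Rightarrow>\<^sub>0 nat"
  have inj: "Poly_Mapping.single v 1 = (Poly_Mapping.single w 1 :: var3 \<Rightarrow>\<^sub>0 nat) \<longleftrightarrow> v = w" for v w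
    by (metis lookup_single_eq lookup_single_not_eq zero_neq_one)
  show "Poly_Mapping.lookup l m = Poly_Mapping.lookup (\<Sum>v\<in>UNIV. Poly_Mapping.single (Poly_Mapping.single v 1)
      (Poly_Mapping.lookup l (Poly_Mapping.single v 1))) m"
  proof (cases "\<exists>v. m = Poly_Mapping.single v 1")
    case True
    then show ?thesis using inj by (auto simp: lookup_sum lookup_single when_def)
  next
    case False
    have "exp_degree m \<noteq> 1"
    proof
      assume deg: "exp_degree m = 1"
      let ?x = "Poly_Mapping.lookup m VX" and ?y = "Poly_Mapping.lookup m VY"
        and ?z = "Poly_Mapping.lookup m VZ"
      have "?x = 1 \<and> ?y = 0 \<and> ?z = 0 \<or> ?x = 0 \<and> ?y = 1 \<and> ?z = 0 \<or> ?x = 0 \<and> ?y = 0 \<and> ?z = 1"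
        using deg unfolding exp_degree_def by arith
      then have "m = exps 1 0 0 \<or> m = exps 0 1 0 \<or> m = exps 0 0 1"
        using exps_lookup[of m] by metis
      then show False using False by (auto simp: exps_def)
    qed
    then have "Poly_Mapping.lookup l m = 0"
      using assms by (auto simp: forms_def in_keys_iff)
    moreover have "Poly_Mapping.single v 1 \<noteq> m" for v using False by blast
    ultimately show ?thesis by (simp add: lookup_sum lookup_single when_def)
  qed
qed

text \<open>Only monomials outside the ideal contribute, as a divisor of a monomial outside the
  ideal is itself outside.\<close>
lemma lookup_linear_form_mult:
  fixes l q :: "'k::field poly3"
  assumes "l \<in> forms 1" "y \<in> std_monomials a b c \<alpha> \<beta> \<gamma> (Suc d)"
  shows "Poly_Mapping.lookup (l * q) y = (\<Sum>x\<in>std_monomials a b c \<alpha> \<beta> \<gamma> d.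
    linear_weight (\<lambda>v. Poly_Mapping.lookup l (Poly_Mapping.single v 1)) y x * Poly_Mapping.lookup q x)"
proof -
  let ?l = "\<lambda>v. Poly_Mapping.lookup l (Poly_Mapping.single v 1)"
  let ?S = "std_monomials a b c \<alpha> \<beta> \<gamma> d"
  have x: "x \<in> ?S" if "y = Poly_Mapping.single v 1 + x" for v x
    using assms(2) in_mon_ideal_add that
    by (auto simp: std_monomials_def exp_degree_add exp_degree_single)
  have "Poly_Mapping.lookup (l * q) y
      = (\<Sum>v\<in>UNIV. Poly_Mapping.lookup (Poly_Mapping.single (Poly_Mapping.single v 1) (?l v) * q) y)"
    by (subst linear_form_eq[OF assms(1)]) (simp add: sum_distrib_right lookup_sum)
  also have "\<dots> = (\<Sum>v\<in>UNIV. \<Sum>x\<in>?S. if y = Poly_Mapping.single v 1 + x then ?l v * Poly_Mapping.lookup q x else 0)"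
    by (intro sum.cong refl lookup_times_single finite_std_monomials x)
  also have "\<dots> = (\<Sum>x\<in>?S. linear_weight ?l y x * Poly_Mapping.lookup q x)"
    unfolding linear_weight_def sum_distrib_right
    by (subst sum.swap) (intro sum.cong refl, simp)
  finally show ?thesis .
qed

lemma linear_weight_eq:
  "linear_weight l y x = of_int (linear_weight (\<lambda>_. 1) y x)
    * (\<Prod>v\<in>UNIV. l v ^ (Poly_Mapping.lookup y v - Poly_Mapping.lookup x v))"
proof (cases "\<exists>v. y = Poly_Mapping.single v 1 + x")
  case True
  then obtain v where v: "y = Poly_Mapping.single v 1 + x" by blast
  have uniq: "y = Poly_Mapping.single w 1 + x \<longleftrightarrow> w = v" for w
    unfolding v by (metis add_right_cancel lookup_single_eq lookup_single_not_eq zero_neq_one)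
  have "(\<Prod>w\<in>UNIV. l w ^ (Poly_Mapping.lookup y w - Poly_Mapping.lookup x w))
      = (\<Prod>w\<in>UNIV. if w = v then l w else 1)"
    by (intro prod.cong refl) (simp add: v lookup_add lookup_single when_def)
  then show ?thesis unfolding linear_weight_def uniq by simp
next
  case False
  then show ?thesis by (simp add: linear_weight_def)
qed

text \<open>Along a perfect matching \<open>g\<close> every exponent difference is nonnegative, and the differences add up to
  a total that depends on the two sets of monomials alone. This is why one constant serves for
  all terms of the determinant, including those for which some coefficients of \<open>l\<close> are 0.\<close>
lemma linear_weight_prod:
  fixes l :: "var3 \<Rightarrow> 'k::field"
  assumes g: "bij_betw g S T"
  shows "(\<Prod>x\<in>S. linear_weight l (g x) x)
    = (\<Prod>v\<in>UNIV. l v ^ ((\<Sum>y\<in>T. Poly_Mapping.lookup y v) - (\<Sum>x\<in>S. Poly_Mapping.lookup x v)))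
      * of_int (\<Prod>x\<in>S. linear_weight (\<lambda>_. 1) (g x) x)"
proof (cases "(\<Prod>x\<in>S. linear_weight (\<lambda>_. 1) (g x) x :: int) = 0")
  case True
  then have "finite S" by (rule contrapos_pp) simp
  with True obtain x where "finite S" "x \<in> S" "(linear_weight (\<lambda>_. 1) (g x) x :: int) = 0"
    by (auto simp: prod_zero_iff)
  then have "(\<Prod>x\<in>S. linear_weight l (g x) x) = 0"
    using linear_weight_eq[of l "g x" x] by auto
  then show ?thesis using True by simp
next
  case False
  have le: "Poly_Mapping.lookup x v \<le> Poly_Mapping.lookup (g x) v" if "finite S" "x \<in> S" for x v
  proof -
    have "(linear_weight (\<lambda>_. 1) (g x) x :: int) \<noteq> 0" using False that by auto
    then have "\<exists>w. g x = Poly_Mapping.single w 1 + x"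
      by (rule contrapos_np) (simp add: linear_weight_def)
    then obtain w where "g x = Poly_Mapping.single w 1 + x" ..
    then show ?thesis by (simp add: lookup_add)
  qed
  have expo: "(\<Sum>x\<in>S. Poly_Mapping.lookup (g x) v - Poly_Mapping.lookup x v)
      = (\<Sum>y\<in>T. Poly_Mapping.lookup y v) - (\<Sum>x\<in>S. Poly_Mapping.lookup x v)" for v
    using sum_subtractf_nat[of S "\<lambda>x. Poly_Mapping.lookup x v" "\<lambda>x. Poly_Mapping.lookup (g x) v"] le
      sum.reindex_bij_betw[OF g, of "\<lambda>y. Poly_Mapping.lookup y v"]
    by (cases "finite S") (use bij_betw_finite[OF g] in auto)
  have "(\<Prod>x\<in>S. linear_weight l (g x) x)
      = of_int (\<Prod>x\<in>S. linear_weight (\<lambda>_. 1) (g x) x)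
        * (\<Prod>x\<in>S. \<Prod>v\<in>UNIV. l v ^ (Poly_Mapping.lookup (g x) v - Poly_Mapping.lookup x v))"
    by (subst linear_weight_eq) (simp add: prod.distrib)
  also have "(\<Prod>x\<in>S. \<Prod>v\<in>UNIV. l v ^ (Poly_Mapping.lookup (g x) v - Poly_Mapping.lookup x v))
      = (\<Prod>v\<in>UNIV. l v ^ (\<Sum>x\<in>S. Poly_Mapping.lookup (g x) v - Poly_Mapping.lookup x v))"
    by (subst prod.swap) (simp add: power_sum)
  finally show ?thesis by (simp add: expo mult.commute)
qed

section \<open>Failure of the weak Lefschetz property\<close>

definition swap_xy :: "(var3 \<Rightarrow>\<^sub>0 nat) \<Rightarrow> (var3 \<Rightarrow>\<^sub>0 nat)" where
  "swap_xy m = exps (Poly_Mapping.lookup m VY) (Poly_Mapping.lookup m VX) (Poly_Mapping.lookup m VZ)"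

lemma swap_xy_involution: "swap_xy (swap_xy m) = m"
  by (rule exps_eqI) (simp_all add: swap_xy_def)

lemma swap_xy_fixed: "swap_xy m = m \<longleftrightarrow> Poly_Mapping.lookup m VX = Poly_Mapping.lookup m VY"
  using exps_lookup[of m] unfolding swap_xy_def by (metis lookup_exps(1,2))

lemma swap_xy_std_monomials:
  "m \<in> std_monomials a a c \<alpha> \<alpha> \<gamma> d \<Longrightarrow> swap_xy m \<in> std_monomials a a c \<alpha> \<alpha> \<gamma> d"
  by (auto simp: swap_xy_def std_monomials_def in_mon_ideal_def exp_degree_def)

lemma linear_weight_swap_xy:
  "(linear_weight (\<lambda>_. 1) (swap_xy y) (swap_xy x) :: int) = linear_weight (\<lambda>_. 1) y x"
proof -
  have add: "swap_xy (m + m') = swap_xy m + swap_xy m'" for m m'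
    by (rule exps_eqI) (simp_all add: swap_xy_def lookup_add)
  define \<pi> where "\<pi> v = (case v of VX \<Rightarrow> VY | VY \<Rightarrow> VX | VZ \<Rightarrow> VZ)" for v
  have single: "swap_xy (Poly_Mapping.single v 1) = Poly_Mapping.single (\<pi> v) 1" for v
    by (cases v; rule exps_eqI) (simp_all add: swap_xy_def \<pi>_def lookup_single)
  have bij: "bij \<pi>"
    by (rule o_bij[of \<pi>]) (auto simp: \<pi>_def fun_eq_iff split: var3.splits)
  have eq: "swap_xy y = Poly_Mapping.single (\<pi> v) 1 + swap_xy x \<longleftrightarrow> y = Poly_Mapping.single v 1 + x" for v
    by (metis add single swap_xy_involution)
  show ?thesis
    unfolding linear_weight_def
    by (subst sum.reindex_bij_betw[OF bij, symmetric]) (simp only: eq)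
qed

text \<open>Translation to linear algebra: the class of a form of degree \<open>d\<close> is determined by its
  coefficients at the monomials outside the ideal. Surjectivity is expressed dually, by the absence of
  a nonzero functional \<open>u\<close> that vanishes on the image.\<close>
lemma weak_Lefschetz_maximal_rank:
  fixes a b c \<alpha> \<beta> \<gamma> :: int
  defines "S \<equiv> std_monomials (nat a) (nat b) (nat c) (nat \<alpha>) (nat \<beta>) (nat \<gamma>)"
  assumes "weak_Lefschetz (poly3_ring Quot (ideal_I a b c \<alpha> \<beta> \<gamma> :: 'k::field poly3 set))
    (quot_component (ideal_I a b c \<alpha> \<beta> \<gamma>))"
  shows "\<exists>l :: var3 \<Rightarrow> 'k. \<forall>d.
    (\<forall>v. (\<forall>y\<in>S (Suc d). (\<Sum>x\<in>S d. linear_weight l y x * v x) = 0) \<longrightarrow> (\<forall>x\<in>S d. v x = 0)) \<or>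
    (\<forall>u. (\<forall>x\<in>S d. (\<Sum>y\<in>S (Suc d). linear_weight l y x * u y) = 0) \<longrightarrow> (\<forall>y\<in>S (Suc d). u y = 0))"
proof -
  let ?I = "ideal_I a b c \<alpha> \<beta> \<gamma> :: 'k poly3 set"
  let ?R = "poly3_ring :: 'k poly3 ring"
  let ?Q = "?R Quot ?I"
  interpret ideal ?I ?R by (rule ideal_ideal_I)
  have fin: "finite (S d)" for d by (simp add: S_def finite_std_monomials)
  have coset_eqD: "p - q \<in> ?I" if "?I +>\<^bsub>?R\<^esub> p = ?I +>\<^bsub>?R\<^esub> q" for p q
  proof -
    have "p \<in> ?I +>\<^bsub>?R\<^esub> q" using a_rcos_self[of p] that by simp
    then obtain i where "i \<in> ?I" "p = i + q" by (auto simp: a_r_coset_def')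
    then show ?thesis by simp
  qed
  have coset_eqI: "?I +>\<^bsub>?R\<^esub> p = ?I +>\<^bsub>?R\<^esub> q" if "p - q \<in> ?I" for p q
  proof (rule a_repr_independence'[symmetric])
    show "p \<in> ?I +>\<^bsub>?R\<^esub> q" using that by (auto simp: a_r_coset_def' intro!: bexI[of _ "p - q"])
  qed simp
  have mult: "(?I +>\<^bsub>?R\<^esub> p) \<otimes>\<^bsub>?Q\<^esub> (?I +>\<^bsub>?R\<^esub> q) = ?I +>\<^bsub>?R\<^esub> (p * q)" for p q
    using rcoset_mult_add[of p q] by (simp add: FactRing_def)
  have not_in_ideal: "Poly_Mapping.lookup p m = 0" if "p \<in> ?I" "m \<in> S d" for p m d
    using that by (auto simp: mem_ideal_I_iff S_def std_monomials_def in_keys_iff)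
  obtain L where "L \<in> quot_component ?I 1"
    and L: "\<And>d. inj_on (\<lambda>q. L \<otimes>\<^bsub>?Q\<^esub> q) (quot_component ?I d)
      \<or> (\<lambda>q. L \<otimes>\<^bsub>?Q\<^esub> q) ` quot_component ?I d = quot_component ?I (d + 1)"
    using assms(2) unfolding weak_Lefschetz_def by blast
  then obtain l where l: "l \<in> forms 1" "L = ?I +>\<^bsub>?R\<^esub> l" by (auto simp: quot_component_def)
  define h where "h = (\<lambda>v. Poly_Mapping.lookup l (Poly_Mapping.single v 1))"
  have coeff: "Poly_Mapping.lookup (l * q) y = (\<Sum>x\<in>S d. linear_weight h y x * Poly_Mapping.lookup q x)"
    if "y \<in> S (Suc d)" for q y d
    using lookup_linear_form_mult[OF l(1)] that unfolding S_def h_def by blast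
  have "(\<forall>v. (\<forall>y\<in>S (Suc d). (\<Sum>x\<in>S d. linear_weight h y x * v x) = 0) \<longrightarrow> (\<forall>x\<in>S d. v x = 0)) \<or>
    (\<forall>u. (\<forall>x\<in>S d. (\<Sum>y\<in>S (Suc d). linear_weight h y x * u y) = 0) \<longrightarrow> (\<forall>y\<in>S (Suc d). u y = 0))"
    for d
    using L[of "int d"]
  proof (elim disjE)
    assume inj: "inj_on (\<lambda>q. L \<otimes>\<^bsub>?Q\<^esub> q) (quot_component ?I (int d))"
    have "\<forall>x\<in>S d. v x = 0" if ker: "\<forall>y\<in>S (Suc d). (\<Sum>x\<in>S d. linear_weight h y x * v x) = 0" for v
    proof -
      \<comment> \<open>The form whose coefficient vector is the given kernel vector.\<close>
      define p where "p = (\<Sum>x\<in>S d. Poly_Mapping.single x (v x))"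
      have p: "Poly_Mapping.lookup p m = (if m \<in> S d then v m else 0)" for m
        using fin[of d] by (simp add: p_def lookup_sum lookup_single when_def)
      have p_form: "p \<in> forms (int d)"
        by (auto simp: forms_def in_keys_iff p S_def std_monomials_def split: if_splits)
      have "in_mon_ideal (nat a) (nat b) (nat c) (nat \<alpha>) (nat \<beta>) (nat \<gamma>) m"
        if m: "m \<in> Poly_Mapping.keys (l * p)" for m
      proof (rule ccontr)
        obtain m1 m2 where m12: "m1 \<in> Poly_Mapping.keys l" "m2 \<in> Poly_Mapping.keys p" "m = m1 + m2"
          using keys_mult[of l p] m by blast
        then have "exp_degree m = Suc d"
          using l(1) p_form by (auto simp: forms_def exp_degree_add)
        moreover assume "\<not> ?thesis"
        ultimately have mS: "m \<in> S (Suc d)" by (simp add: S_def std_monomials_def)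
        have "Poly_Mapping.lookup (l * p) m = 0"
          using ker mS by (simp add: coeff[OF mS] p)
        then show False using m by (simp add: in_keys_iff)
      qed
      then have "l * p \<in> ?I" by (simp add: mem_ideal_I_iff)
      then have "L \<otimes>\<^bsub>?Q\<^esub> (?I +>\<^bsub>?R\<^esub> p) = L \<otimes>\<^bsub>?Q\<^esub> (?I +>\<^bsub>?R\<^esub> 0)"
        unfolding l(2) mult by (intro coset_eqI) simp
      moreover have "0 \<in> forms (int d)" by (simp add: forms_def)
      ultimately have "?I +>\<^bsub>?R\<^esub> p = ?I +>\<^bsub>?R\<^esub> 0"
        using inj p_form by (auto simp: inj_on_def quot_component_def)
      from coset_eqD[OF this] have "p \<in> ?I" by simp
      then show ?thesis using not_in_ideal[of p _ d] p by simp
    qed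
    then show ?thesis by blast
  next
    assume surj: "(\<lambda>q. L \<otimes>\<^bsub>?Q\<^esub> q) ` quot_component ?I (int d) = quot_component ?I (int d + 1)"
    have "u y = 0" if coker: "\<forall>x\<in>S d. (\<Sum>y\<in>S (Suc d). linear_weight h y x * u y) = 0"
      and y: "y \<in> S (Suc d)" for u y
    proof -
      \<comment> \<open>Evaluate the functional \<open>u\<close> at a preimage of the class of the monomial \<open>y\<close>.\<close>
      have "Poly_Mapping.single y (1 :: 'k) \<in> forms (int d + 1)"
        using y by (simp add: forms_def S_def std_monomials_def)
      then have "?I +>\<^bsub>?R\<^esub> Poly_Mapping.single y 1 \<in> (\<lambda>q. L \<otimes>\<^bsub>?Q\<^esub> q) ` quot_component ?I (int d)"
        unfolding surj by (simp add: quot_component_def)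
      then obtain q where "?I +>\<^bsub>?R\<^esub> Poly_Mapping.single y 1 = ?I +>\<^bsub>?R\<^esub> (l * q)"
        by (auto simp: quot_component_def l(2) mult)
      then have diff: "Poly_Mapping.single y 1 - l * q \<in> ?I" by (rule coset_eqD)
      have lq: "Poly_Mapping.lookup (l * q) y' = (if y' = y then 1 else 0)" if "y' \<in> S (Suc d)" for y'
        using not_in_ideal[OF diff that] by (simp add: lookup_minus lookup_single when_def split: if_splits)
      have "u y = (\<Sum>y'\<in>S (Suc d). u y' * (if y' = y then 1 else 0))"
        using y fin by (simp add: if_distrib cong: if_cong)
      also have "\<dots> = (\<Sum>y'\<in>S (Suc d). u y' * (\<Sum>x\<in>S d. linear_weight h y' x * Poly_Mapping.lookup q x))"
        by (intro sum.cong refl) (simp add: coeff flip: lq)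
      also have "\<dots> = (\<Sum>x\<in>S d. Poly_Mapping.lookup q x * (\<Sum>y'\<in>S (Suc d). linear_weight h y' x * u y'))"
        unfolding sum_distrib_left by (subst sum.swap) (simp add: ac_simps)
      also have "\<dots> = 0" using coker by simp
      finally show ?thesis .
    qed
    then show ?thesis by blast
  qed
  then show ?thesis by blast
qed

lemma symmetric_not_weak_Lefschetz:
  fixes A G p q :: nat and a c \<alpha> \<gamma> :: int
  assumes a: "a = int (A + 2 * p + 2 * q + 2)" and c: "c = int (2 * A + 2 * q + 1)"
    and \<gamma>: "\<gamma> = int (2 * G + 1)" and \<alpha>: "0 \<le> \<alpha>" "\<alpha> + int G = int (A + p)" and G: "G < A"
  shows "\<not> weak_Lefschetz (poly3_ring Quot (ideal_I a a c \<alpha> \<alpha> \<gamma> :: 'k::field poly3 set))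
    (quot_component (ideal_I a a c \<alpha> \<alpha> \<gamma>))"
proof
  let ?S = "std_monomials (nat a) (nat a) (nat c) (nat \<alpha>) (nat \<alpha>) (nat \<gamma>)"
  define s where "s = 2 * A + 2 * p + 2 * q"
  assume wl: "weak_Lefschetz (poly3_ring Quot (ideal_I a a c \<alpha> \<alpha> \<gamma> :: 'k poly3 set))
    (quot_component (ideal_I a a c \<alpha> \<alpha> \<gamma>))"
  obtain l :: "var3 \<Rightarrow> 'k" where l:
    "(\<forall>v. (\<forall>y\<in>?S (Suc s). (\<Sum>x\<in>?S s. linear_weight l y x * v x) = 0) \<longrightarrow> (\<forall>x\<in>?S s. v x = 0)) \<or>
     (\<forall>u. (\<forall>x\<in>?S s. (\<Sum>y\<in>?S (Suc s). linear_weight l y x * u y) = 0) \<longrightarrow> (\<forall>y\<in>?S (Suc s). u y = 0))"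
    using weak_Lefschetz_maximal_rank[OF wl] by (elim exE allE[of _ s]) (rule that)
  have nats: "nat a = A + 2 * p + 2 * q + 2" "nat c = 2 * A + 2 * q + 1" "nat \<gamma> = 2 * G + 1"
    "nat \<alpha> + G = A + p" using a c \<gamma> \<alpha> by auto
  have fixed: "card {x \<in> ?S s. swap_xy x = x} = card {y \<in> ?S (Suc s). swap_xy y = y} + 2"
    unfolding swap_xy_fixed by (rule card_symmetric_std_monomials[OF nats G s_def])
  note singular = singular_of_involutions[where U = "?S s" and V = "?S (Suc s)" and rx = swap_xy
      and ry = swap_xy and W = "linear_weight (\<lambda>_. 1)" and w = "linear_weight l", OF finite_std_monomials finite_std_monomials
      card_std_monomials_eq[OF nats G s_def] swap_xy_std_monomials swap_xy_involution
      swap_xy_std_monomials swap_xy_involution linear_weight_swap_xy fixed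
      linear_weight_prod[where S = "?S s" and T = "?S (Suc s)"]]
  from l show False
  proof
    assume inj: "\<forall>v. (\<forall>y\<in>?S (Suc s). (\<Sum>x\<in>?S s. linear_weight l y x * v x) = 0) \<longrightarrow> (\<forall>x\<in>?S s. v x = 0)"
    have "\<exists>v. (\<exists>x\<in>?S s. v x \<noteq> 0) \<and> (\<forall>y\<in>?S (Suc s). (\<Sum>x\<in>?S s. linear_weight l y x * v x) = 0)"
      by (rule singular(1)) assumption+
    then obtain v where v: "\<exists>x\<in>?S s. v x \<noteq> 0"
      "\<forall>y\<in>?S (Suc s). (\<Sum>x\<in>?S s. linear_weight l y x * v x) = 0"
      by (elim exE conjE) (rule that)
    from mp[OF spec[OF inj, of v] v(2)] v(1) show False by simp
  next
    assume surj: "\<forall>u. (\<forall>x\<in>?S s. (\<Sum>y\<in>?S (Suc s). linear_weight l y x * u y) = 0) \<longrightarrow> (\<forall>y\<in>?S (Suc s). u y = 0)"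
    have "\<exists>u. (\<exists>y\<in>?S (Suc s). u y \<noteq> 0) \<and> (\<forall>x\<in>?S s. (\<Sum>y\<in>?S (Suc s). linear_weight l y x * u y) = 0)"
      by (rule singular(2)) assumption+
    then obtain u where u: "\<exists>y\<in>?S (Suc s). u y \<noteq> 0"
      "\<forall>x\<in>?S s. (\<Sum>y\<in>?S (Suc s). linear_weight l y x * u y) = 0"
      by (elim exE conjE) (rule that)
    from mp[OF spec[OF surj, of u] u(2)] u(1) show False by simp
  qed
qed

theorem proposition6p14:
  fixes a b c \<alpha> \<beta> \<gamma> s A B C M :: int
  assumes "0 \<le> \<alpha>" "\<alpha> < a" "0 \<le> \<beta>" "\<beta> < b" "0 \<le> \<gamma>" "\<gamma> < c"
    and "\<not> (\<alpha> = 0 \<and> \<beta> = 0)" "\<not> (\<alpha> = 0 \<and> \<gamma> = 0)" "\<not> (\<beta> = 0 \<and> \<gamma> = 0)"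
    and "[a + b + c + \<alpha> + \<beta> + \<gamma> = 0] (mod 3)"
    and "s = s_param a b c \<alpha> \<beta> \<gamma>"
    and "A = s + 2 - a" "B = s + 2 - b" "C = s + 2 - c" "M = s + 2 - (\<alpha> + \<beta> + \<gamma>)"
    and "0 \<le> M" "0 \<le> A" "A \<le> \<beta> + \<gamma>" "0 \<le> B" "B \<le> \<alpha> + \<gamma>" "0 \<le> C" "C \<le> \<alpha> + \<beta>"
    and "odd c" "odd \<gamma>" "a = b" "\<alpha> = \<beta>"
  shows "symmetric_region (punctured_hexagon a a c \<alpha> \<alpha> \<gamma>) \<and> odd M
    \<and> det (N_matrix a a c \<alpha> \<alpha> \<gamma>) = 0
    \<and> (infinite (UNIV :: 'k::field set) \<longrightarrow>
        (let I = (ideal_I a a c \<alpha> \<alpha> \<gamma> :: 'k poly3 set)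
         in \<not> weak_Lefschetz (poly3_ring Quot I) (quot_component I)))"
proof (intro conjI impI)
  have dvd: "3 dvd a + a + c + \<alpha> + \<alpha> + \<gamma>"
    using assms(10,25,26) by (simp add: cong_0_iff)
  then have sum: "a + a + c + \<alpha> + \<alpha> + \<gamma> = 3 * (s + 2)"
    using assms(11,25,26) by (simp add: s_param_def)
  have odd_C: "odd C" and odd_M: "odd M"
    using sum assms(14,15,23-26) by presburger+
  show "odd M" by (rule odd_M)
  show "det (N_matrix a a c \<alpha> \<alpha> \<gamma>) = 0"
    using det_N_matrix_symmetric[OF sum] assms(14-16,21,26) odd_C odd_M by simp
  show "symmetric_region (punctured_hexagon a a c \<alpha> \<alpha> \<gamma>)"
  proof -
    let ?H = "punctured_hexagon a a c \<alpha> \<alpha> \<gamma>"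
    let ?r = "\<lambda>(u, v, w). (v, u, w) :: real \<times> real \<times> real"
    have mem: "?r t \<in> ?H" if "t \<in> ?H" for t
      using that by (auto simp: punctured_hexagon_def puncture_def)
    have "t \<in> ?r ` ?H" if "t \<in> ?H" for t
      by (rule image_eqI[OF _ mem[OF that]]) (simp add: case_prod_beta)
    then show ?thesis unfolding symmetric_region_def using mem by (intro subset_antisym image_subsetI subsetI)
  qed
  obtain p q G where pqG: "C = 2 * p + 1" "M = 2 * q + 1" "\<gamma> = 2 * G + 1"
    using odd_C odd_M assms(24) by (auto elim!: oddE)
  have "\<not> weak_Lefschetz (poly3_ring Quot (ideal_I a a c \<alpha> \<alpha> \<gamma> :: 'k poly3 set))
    (quot_component (ideal_I a a c \<alpha> \<alpha> \<gamma>))"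
  proof (rule symmetric_not_weak_Lefschetz[where A = "nat A" and p = "nat p" and q = "nat q" and G = "nat G"])
    have nonneg: "0 \<le> p" "0 \<le> q" "0 \<le> G" "0 \<le> A"
      using pqG assms(5,16,17,21) by linarith+
    have "2 * (\<alpha> + G) = 2 * (A + p)"
      using sum pqG assms(12,14,15,25,26) by presburger
    then have \<alpha>: "\<alpha> + G = A + p" by simp
    have "G < A" using \<alpha> pqG(1) assms(22,26) by linarith
    then show "nat G < nat A" using nonneg by simp
    show "\<alpha> + int (nat G) = int (nat A + nat p)" "\<gamma> = int (2 * nat G + 1)" "0 \<le> \<alpha>"
      using \<alpha> nonneg pqG(3) assms(1) by simp_all
    show "a = int (nat A + 2 * nat p + 2 * nat q + 2)" "c = int (2 * nat A + 2 * nat q + 1)"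
      using nonneg sum pqG assms(12,14,15,25,26) by simp_all
  qed
  then show "let I = (ideal_I a a c \<alpha> \<alpha> \<gamma> :: 'k poly3 set)
      in \<not> weak_Lefschetz (poly3_ring Quot I) (quot_component I)"
    by (simp add: Let_def)
qed

end
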